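(* Let $s$ be a nonzero real number. Then \[ \sum_{n=1}^{\infty}\frac{1}{\{2n-1\}_{s,1}}=-\frac{\sqrt{s^2+4}}{4}\,\theta_2\!\left(\varphi_{s,1}^{\prime2}\right)^2. \]
   Context: The generalized Fibonacci polynomials $\{n\}_{s,1}$ are defined by $\{0\}_{s,1}=0$, $\{1\}_{s,1}=1$, $\{n+2\}_{s,1}=s\{n+1\}_{s,1}+\{n\}_{s,1}$. Set $\varphi'_{s,1}=\frac{s-\sqrt{s^2+4}}{2}$. The Jacobi theta function is $\theta_2(q)=\sum_{n=-\infty}^{\infty}q^{(n+1/2)^2}$.
   Formalization: Proved for s > 0 only: for s < 0 the argument φ'² exceeds 1 and the theta series diverges. The powers of q = φ'² in θ₂ are taken on the branch with q^{1/2} = φ' (negative); with positive real powers the right side would be negative and the left positive. *)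

theory Defs
  imports "HOL-Analysis.Analysis"
begin

text \<open>The generalized Fibonacci polynomial \<open>{n}\<^sub>s\<^sub>,\<^sub>1\<close>, evaluated at a real \<open>s\<close>.\<close>

fun gfib :: "real \<Rightarrow> nat \<Rightarrow> real" where
  "gfib s 0 = 0"
| "gfib s (Suc 0) = 1"
| "gfib s (Suc (Suc n)) = s * gfib s (Suc n) + gfib s n"

definition phi' :: "real \<Rightarrow> real" where
  "phi' s = (s - sqrt (s\<^sup>2 + 4)) / 2"

text \<open>
  The series \<open>\<theta>\<^sub>2(q) = \<Sum>n. q\<^bsup>(n + 1/2)\<^sup>2\<^esup>\<close> involves \<open>q\<^bsup>1/4\<^esup>\<close>, so its value depends on a
  branch, and so does the sign of its square. As is usual for theta functions, the branch is
  carried by \<open>\<tau>\<close> in the upper half plane (equivalently \<open>\<bar>q\<bar> < 1\<close>), with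
  \<open>q\<^sup>x = exp (\<i> \<pi> \<tau> x)\<close>.
\<close>

definition nome_power :: "complex \<Rightarrow> real \<Rightarrow> complex" where
  "nome_power \<tau> x = exp (\<i> * of_real pi * \<tau> * of_real x)"

definition jacobi_theta2 :: "complex \<Rightarrow> complex" where
  "jacobi_theta2 \<tau> = (\<Sum>\<^sub>\<infinity>n\<in>(UNIV :: int set). nome_power \<tau> ((of_int n + 1/2)\<^sup>2))"

lemma phi'_neg: "phi' s < 0"
proof -
  have "\<bar>s\<bar> < sqrt (s\<^sup>2 + 4)" by (rule real_less_rsqrt) simp
  then show ?thesis by (simp add: phi'_def)
qed

lemma abs_phi'_less_1_iff: "\<bar>phi' s\<bar> < 1 \<longleftrightarrow> s > 0"
proof -
  have "\<bar>phi' s\<bar> < 1 \<longleftrightarrow> sqrt (s\<^sup>2 + 4) < s + 2"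
    using phi'_neg[of s] by (auto simp: phi'_def)
  also have "\<dots> \<longleftrightarrow> s > 0"
  proof
    assume *: "sqrt (s\<^sup>2 + 4) < s + 2"
    have "0 \<le> sqrt (s\<^sup>2 + 4)" by simp
    with * have "(sqrt (s\<^sup>2 + 4))\<^sup>2 < (s + 2)\<^sup>2" by (intro power_strict_mono) auto
    then show "s > 0" by (simp add: power2_eq_square algebra_simps)
  next
    assume "s > 0"
    then show "sqrt (s\<^sup>2 + 4) < s + 2"
      by (intro real_less_lsqrt) (auto simp: power2_eq_square algebra_simps)
  qed
  finally show ?thesis .
qed

text \<open>
  The argument \<open>q = phi' s ^ 2\<close> arises as the square of \<open>phi' s\<close>, and its square root is
  accordingly \<open>q\<^bsup>1/2\<^esup> = phi' s\<close>, a negative number. With the positive root, \<open>\<theta>\<^sub>2(q)\<^sup>2\<close> would change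
  sign. Such a \<open>\<tau>\<close> exists exactly if \<open>s > 0\<close>: for \<open>s < 0\<close> we have \<open>phi' s ^ 2 > 1\<close>, and the series
  for \<open>\<theta>\<^sub>2\<close> diverges.
\<close>

lemma ex_phi'_nome_iff: "(\<exists>\<tau>. Im \<tau> > 0 \<and> nome_power \<tau> 1 = (of_real (phi' s))\<^sup>2 \<and>
      nome_power \<tau> (1/2) = of_real (phi' s)) \<longleftrightarrow> s > 0"
  (is "(\<exists>\<tau>. ?P \<tau>) \<longleftrightarrow> _")
proof
  assume "\<exists>\<tau>. ?P \<tau>"
  then obtain \<tau> where \<tau>: "Im \<tau> > 0" "nome_power \<tau> (1/2) = of_real (phi' s)"
    by blast
  have "\<bar>phi' s\<bar> = norm (nome_power \<tau> (1/2))" using \<tau>(2) by simp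
  also have "\<dots> = exp (- pi * Im \<tau> / 2)" by (simp add: nome_power_def)
  also have "\<dots> < 1" using \<tau>(1) by simp
  finally show "s > 0" by (simp add: abs_phi'_less_1_iff)
next
  assume "s > 0"
  then have *: "\<bar>phi' s\<bar> < 1" "phi' s < 0" by (simp_all add: abs_phi'_less_1_iff phi'_neg)
  define w where "w = Ln (of_real (phi' s))"
  define \<tau> where "\<tau> = 2 * w / (\<i> * of_real pi)"
  have w: "exp w = of_real (phi' s)" using * by (simp add: w_def)
  have tau: "\<i> * of_real pi * \<tau> = 2 * w" by (simp add: \<tau>_def)
  have "Re w = ln \<bar>phi' s\<bar>" using * by (simp add: w_def)
  then have "Re w < 0" using * by (simp add: ln_less_zero)
  moreover have "Im \<tau> = - 2 * Re w / pi"
    using arg_cong[OF tau, of Re] by (simp add: field_simps)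
  ultimately have "Im \<tau> > 0" by (simp add: divide_neg_pos)
  moreover have "nome_power \<tau> 1 = (of_real (phi' s))\<^sup>2"
    using w by (simp add: nome_power_def tau exp_double)
  moreover have "nome_power \<tau> (1/2) = of_real (phi' s)"
    using w by (simp add: nome_power_def tau)
  ultimately show "\<exists>\<tau>. ?P \<tau>" by blast
qed

end

theory Submission
  imports Defs
begin

text \<open>
  Put \<open>r = - phi' s\<close>, so \<open>0 < r < 1\<close>, and \<open>\<psi>(x) = \<Sum>n. x\<^bsup>n(n+1)/2\<^esup>\<close>. By Binet's formula the claim is
  \<open>\<Sum>k. p\<^sup>k / (1 + p\<^bsup>2k+1\<^esup>) = \<psi>(p\<^sup>2)\<^sup>2\<close> with \<open>p = r\<^sup>2\<close>, because \<open>\<theta>\<^sub>2\<close> is \<open>2 q\<^bsup>1/4\<^esup> \<psi>(q\<^sup>2)\<close>; the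
  minus sign is \<open>q\<^bsup>1/2\<^esup> = - r\<close>.

  Let \<open>P\<^sub>n(x)\<close> be the product of \<open>(1 - x\<^bsup>2i\<^esup>) / (1 - x\<^bsup>2i-1\<^esup>)\<close> over \<open>1 \<le> i \<le> n\<close>. Shanks' finite form of
  Gauss' identity shows \<open>P\<^sub>n(x) \<longlonglongrightarrow> \<psi>(x)\<close>. On the other side there is the finite identity
  \<open>\<Sum>i<n. p\<^sup>i / (1 + p\<^bsup>2i+1\<^esup>) / (P\<^bsub>n+i\<^esub>(p) P\<^bsub>n-1-i\<^esub>(p)) = (P\<^bsub>n-1\<^esub>(p\<^sup>2) / P\<^bsub>n-1\<^esub>(p) / (1 + p\<^bsup>2n-1\<^esup>))\<^sup>2\<close>,
  which is proved by creative telescoping in \<open>n\<close>. By Tannery's theorem its limit is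
  \<open>\<psi>(p)\<^bsup>-2\<^esup> \<Sum>i. p\<^sup>i / (1 + p\<^bsup>2i+1\<^esup>) = (\<psi>(p\<^sup>2) / \<psi>(p))\<^sup>2\<close>.
\<close>

section \<open>Finite products and Shanks' form of Gauss' identity\<close>

definition gauss_prod :: "real \<Rightarrow> nat \<Rightarrow> real" where
  "gauss_prod x n = (\<Prod>i<n. (1 - x ^ (2 * i + 2)) / (1 - x ^ (2 * i + 1)))"

definition psi :: "real \<Rightarrow> real" where
  "psi x = (\<Sum>k. x ^ (k * (k + 1) div 2))"

lemma gauss_prod_0 [simp]: "gauss_prod x 0 = 1"
  by (simp add: gauss_prod_def)

lemma gauss_prod_Suc:
  "gauss_prod x (Suc n) = gauss_prod x n * ((1 - x ^ (2 * n + 2)) / (1 - x ^ (2 * n + 1)))"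
  by (simp add: gauss_prod_def)

lemma power_lt_one:
  fixes x :: real
  assumes "0 < x" "x < 1" "n > 0"
  shows "x ^ n < 1"
  using assms by (simp add: power_less_one_iff)

text \<open>Besides keeping denominators away from 0, this supplies the bounds for both limit
  arguments: dividing a nonnegative term by such a product never enlarges it.\<close>

lemma gauss_prod_ge_1:
  assumes "0 < x" "x < 1"
  shows "gauss_prod x n \<ge> 1"
  unfolding gauss_prod_def
proof (rule prod_ge_1)
  fix i
  have "x ^ (2 * i + 2) \<le> x ^ (2 * i + 1)" "x ^ (2 * i + 1) < 1"
    using assms by (simp_all add: power_decreasing power_lt_one del: power_Suc)
  then show "1 \<le> (1 - x ^ (2 * i + 2)) / (1 - x ^ (2 * i + 1))"
    by (simp add: le_divide_eq)
qed

text \<open>\<open>G\<close> is the telescoping certificate for Shanks' sum. Once \<open>X\<close>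
  and the quotient of products are factored out, the claim is an identity of rational functions in
  \<open>x\<close>, \<open>A\<close> and \<open>B\<close>.\<close>

lemma shanks_telescope:
  fixes x :: real
  assumes x: "0 < x" "x < 1"
  defines "G \<equiv> \<lambda>m s. (1 - x ^ (2 * s)) * x ^ (s * (2 * m + 1)) / (1 - x ^ (2 * m + 1)) *
                   (gauss_prod x m / gauss_prod x s)"
  shows "gauss_prod x (Suc m) / gauss_prod x s * x ^ (s * (2 * Suc m + 1)) -
         gauss_prod x m / gauss_prod x s * x ^ (s * (2 * m + 1)) = G m (Suc s) - G m s"
proof -
  define A B X where "A = x ^ (2 * s)" and "B = x ^ (2 * m + 1)" and "X = x ^ (s * (2 * m + 1))"
  have [simp]: "gauss_prod x k \<noteq> 0" for k
    using gauss_prod_ge_1[OF x, of k] by linarith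
  have "x ^ (2 * s + 1) < 1" "x ^ (2 * s + 2) < 1" "x ^ (2 * m + 1) < 1"
    using x by (simp_all add: power_lt_one del: power_Suc)
  then have ne: "1 - x * A \<noteq> 0" "1 - x\<^sup>2 * A \<noteq> 0" "1 - B \<noteq> 0"
    by (simp_all add: A_def B_def power_add mult_ac power2_eq_square)
  have 1: "x ^ (s * (2 * Suc m + 1)) = X * A"
    by (simp add: A_def X_def algebra_simps flip: power_add)
  have 2: "x ^ (Suc s * (2 * m + 1)) = X * B"
    by (simp add: B_def X_def algebra_simps flip: power_add)
  have 3: "gauss_prod x (Suc s) = gauss_prod x s * ((1 - x\<^sup>2 * A) / (1 - x * A))"
    by (simp add: gauss_prod_Suc A_def power_add mult_ac power2_eq_square)
  have 4: "gauss_prod x (Suc m) = gauss_prod x m * ((1 - x * B) / (1 - B))"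
    by (simp add: gauss_prod_Suc B_def power_add mult_ac power2_eq_square)
  have 5: "x ^ (2 * Suc s) = x\<^sup>2 * A"
    by (simp add: A_def power2_eq_square)
  show ?thesis unfolding G_def 1 2 3 4 5 A_def[symmetric] B_def[symmetric] X_def[symmetric]
    using ne by (simp add: divide_simps) algebra
qed

text \<open>Induction on \<open>n\<close>. The certificate vanishes at \<open>s = 0\<close> because
  of its factor \<open>1 - x ^ (2 * s)\<close>, so passing from \<open>m\<close> to
  \<open>m + 1\<close> adds only its value at \<open>s = m\<close> and the new summand
  \<open>s = m\<close>. Together these are the two next powers, with exponents
  \<open>m * (2 * m + 1)\<close> and \<open>(m + 1) * (2 * m + 1)\<close>.\<close>

lemma shanks_partial_sums:
  fixes x :: real
  assumes x: "0 < x" "x < 1"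
  shows "(\<Sum>s<n. gauss_prod x n / gauss_prod x s * x ^ (s * (2 * n + 1))) =
         (\<Sum>k<2*n. x ^ (k * (k + 1) div 2))"
proof (induction n)
  case 0
  show ?case by simp
next
  case (Suc m)
  let ?P = "gauss_prod x"
  define B X where "B = x ^ (2 * m + 1)" and "X = x ^ (m * (2 * m + 1))"
  have [simp]: "?P k \<noteq> 0" for k
    using gauss_prod_ge_1[OF x, of k] by linarith
  have "B < 1"
    using x by (simp add: power_lt_one B_def del: power_Suc)
  have "(\<Sum>s<m. ?P (Suc m) / ?P s * x ^ (s * (2 * Suc m + 1)) - 
                ?P m / ?P s * x ^ (s * (2 * m + 1))) =
        (1 - x ^ (2 * m)) * X / (1 - B)"
    unfolding shanks_telescope[OF x]
    using sum_lessThan_telescope[of "\<lambda>s. (1 - x ^ (2 * s)) * x ^ (s * (2 * m + 1)) / 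
      (1 - x ^ (2 * m + 1)) * (?P m / ?P s)" m]
    by (simp only: B_def X_def) simp
  then have "(\<Sum>s<Suc m. ?P (Suc m) / ?P s * x ^ (s * (2 * Suc m + 1))) =
        (\<Sum>k<2*m. x ^ (k * (k + 1) div 2)) + (1 - x ^ (2 * m)) * X / (1 - B) +
        ?P (Suc m) / ?P m * x ^ (m * (2 * Suc m + 1))"
    unfolding sum_subtractf Suc.IH sum.lessThan_Suc by linarith
  also have "?P (Suc m) / ?P m * x ^ (m * (2 * Suc m + 1)) = 
             (1 - x * B) / (1 - B) * (X * x ^ (2 * m))"
  proof -
    have "?P (Suc m) / ?P m = (1 - x * B) / (1 - B)"
      by (simp add: gauss_prod_Suc B_def)
    moreover have "x ^ (m * (2 * Suc m + 1)) = X * x ^ (2 * m)"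
      by (simp add: X_def algebra_simps flip: power_add)
    ultimately show ?thesis by simp
  qed
  also have "(\<Sum>k<2*m. x ^ (k * (k + 1) div 2)) + (1 - x ^ (2 * m)) * X / (1 - B) +
        (1 - x * B) / (1 - B) * (X * x ^ (2 * m)) = 
        (\<Sum>k<2*m. x ^ (k * (k + 1) div 2)) + X + X * B"
  proof -
    \<comment> \<open>With \<open>B = x * A\<close> the mixed terms cancel, and the two numerators
      add up to \<open>X * (1 - B * B)\<close>.\<close>
    have "T + (1 - A) * X / (1 - B) + (1 - x * B) / (1 - B) * (X * A) = T + X + X * B"
      if "B = x * A" for T A
    proof -
      have "(1 - A) * X + (1 - x * B) * (X * A) = (X + X * B) * (1 - B)"
        unfolding that by algebra
      then show ?thesis using \<open>B < 1\<close>
        by (simp add: add_divide_distrib[symmetric] nonzero_divide_eq_eq add.assoc)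
    qed
    then show ?thesis by (simp add: B_def)
  qed
  also have "\<dots> = (\<Sum>k<2 * Suc m. x ^ (k * (k + 1) div 2))"
  proof -
    have "2 * m * (2 * m + 1) div 2 = m * (2 * m + 1)" by simp
    moreover have "(2 * m + 1) * (2 * m + 2) div 2 = m * (2 * m + 1) + (2 * m + 1)"
      by (simp add: algebra_simps)
    ultimately have "x ^ (2 * m * (2 * m + 1) div 2) = X" 
      "x ^ (Suc (2 * m) * (Suc (2 * m) + 1) div 2) = X * B"
      by (simp_all add: X_def B_def algebra_simps flip: power_add)
    moreover have "2 * Suc m = Suc (Suc (2 * m))" by simp
    ultimately show ?thesis by (simp only: sum.lessThan_Suc)
  qed
  finally show ?case .
qed

lemma summable_psi:
  fixes x :: real
  assumes x: "0 < x" "x < 1"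
  shows "summable (\<lambda>k. x ^ (k * (k + 1) div 2))"
proof (rule summable_comparison_test')
  show "summable (\<lambda>k. x ^ k)" using x by simp
  fix k :: nat
  have "k \<le> k * (k + 1) div 2" by (cases k) auto
  then show "norm (x ^ (k * (k + 1) div 2)) \<le> x ^ k"
    using x by (simp add: power_decreasing)
qed

text \<open>The summand \<open>s = 0\<close> of Shanks' sum is the product itself, and the other
  summands are nonnegative and tend to 0 in total. So the product is squeezed between the partial
  sum of \<open>psi x\<close> and that sum minus a vanishing error.\<close>

lemma gauss_prod_tendsto:
  assumes x: "0 < x" "x < 1"
  shows "gauss_prod x \<longlonglongrightarrow> psi x"
proof -
  let ?P = "gauss_prod x" and ?S = "\<lambda>n. \<Sum>k<2*n. x ^ (k * (k + 1) div 2)"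
  have lim: "?S \<longlonglongrightarrow> psi x"
  proof -
    have "(\<lambda>n. \<Sum>k<n. x ^ (k * (k + 1) div 2)) \<longlonglongrightarrow> psi x"
      unfolding psi_def by (rule summable_LIMSEQ[OF summable_psi[OF x]])
    then show ?thesis
      by (rule LIMSEQ_subseq_LIMSEQ[where f = "\<lambda>n. 2 * n", unfolded comp_def])
         (simp add: strict_mono_def)
  qed
  have P: "?P k \<ge> 1" for k by (rule gauss_prod_ge_1[OF x])
  have split: "?S (Suc m) = ?P (Suc m) + 
     (\<Sum>s<m. ?P (Suc m) / ?P (Suc s) * x ^ (Suc s * (2 * Suc m + 1)))" for m
    unfolding shanks_partial_sums[OF x, symmetric] sum.lessThan_Suc_shift by simp
  have upper: "?P (Suc m) \<le> ?S (Suc m)" for m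
    unfolding split using P[THEN order_trans[OF zero_le_one]] x
    by (simp add: sum_nonneg del: power_Suc)
  have S_le: "?S n \<le> psi x" for n
    unfolding psi_def using x by (intro sum_le_suminf summable_psi) auto
  \<comment> \<open>Each of the \<open>m\<close> remaining summands is at most
    \<open>psi x * x ^ m\<close>: the denominator is at least 1, the numerator is at most
    \<open>psi x\<close> by \<open>upper\<close>, and the exponent is at least
    \<open>m\<close>.\<close>
  have lower: "?S (Suc m) - psi x * (real m * x ^ m) \<le> ?P (Suc m)" for m
  proof -
    have "(\<Sum>s<m. ?P (Suc m) / ?P (Suc s) * x ^ (Suc s * (2 * Suc m + 1))) \<le> 
          (\<Sum>s<m. psi x * x ^ m)"
    proof (intro sum_mono mult_mono)
      fix s
      have "?P (Suc m) / ?P (Suc s) \<le> ?P (Suc m) / 1"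
        using P[of "Suc m"] P[of "Suc s"] by (intro divide_left_mono) auto
      also have "\<dots> \<le> psi x" using upper[of m] S_le[of "Suc m"] by simp
      finally show "?P (Suc m) / ?P (Suc s) \<le> psi x" .
      show "x ^ (Suc s * (2 * Suc m + 1)) \<le> x ^ m"
        using x by (intro power_decreasing) auto
      show "0 \<le> psi x" using P[of "Suc m"] upper[of m] S_le[of "Suc m"] by simp
    qed (use x in auto)
    then show ?thesis unfolding split by (simp add: mult_ac)
  qed
  have "(\<lambda>m. ?P (Suc m)) \<longlonglongrightarrow> psi x"
  proof (rule tendsto_sandwich)
    have "(\<lambda>m. ?S (Suc m) - psi x * (real m * x ^ m)) \<longlonglongrightarrow> psi x - psi x * 0"
      using x by (intro tendsto_intros LIMSEQ_Suc[OF lim] powser_times_n_limit_0) auto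
    then show "(\<lambda>m. ?S (Suc m) - psi x * (real m * x ^ m)) \<longlonglongrightarrow> psi x" by simp
    show "(\<lambda>m. ?S (Suc m)) \<longlonglongrightarrow> psi x" by (rule LIMSEQ_Suc[OF lim])
    show "\<forall>\<^sub>F m in sequentially. ?S (Suc m) - psi x * (real m * x ^ m) \<le> ?P (Suc m)"
      by (rule always_eventually) (rule allI, rule lower)
    show "\<forall>\<^sub>F m in sequentially. ?P (Suc m) \<le> ?S (Suc m)"
      by (rule always_eventually) (rule allI, rule upper)
  qed
  then show ?thesis by (rule LIMSEQ_imp_Suc)
qed

section \<open>Creative telescoping for the finite Lambert sum\<close>

text \<open>
  The creative-telescoping identity in rational form: \<open>u = p\<^bsup>2n\<^esup>\<close>, \<open>v = p\<^bsup>2i\<^esup>\<close>, and \<open>\<alpha>\<close>, \<open>\<beta>\<close> are the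
  ratios of consecutive factors \<open>1 / gauss_prod\<close>. Both sides reduce to the same multiple of
  \<open>1 + p v\<close>.
\<close>

lemma wz_certificate:
  fixes p u v :: real
  assumes ne: "p \<noteq> 0" "v \<noteq> 0" "v - u \<noteq> 0" "1 - p\<^sup>2 * u * v \<noteq> 0" "1 - u \<noteq> 0" "1 - p * u \<noteq> 0" 
     "1 + p * u \<noteq> 0" "1 + p * v \<noteq> 0"
  defines "\<alpha> \<equiv> (1 - p * u * v) / (1 - p\<^sup>2 * u * v)" and "\<beta> \<equiv> (p * v - u) / (p * (v - u))"
  shows "(\<alpha> * \<beta> - ((1 + u) / (1 + p * u))\<^sup>2) / (1 + p * v) =
     u * (1 - p * u\<^sup>2) / ((1 + p * u)\<^sup>2 * (1 - u) * (1 - p * u)) *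
     ((1 - v) * \<beta> - (1 - p\<^sup>2 * v) * \<alpha> / p) / v"
proof -
  define E where "E = p * (v - u) * (1 - p\<^sup>2 * u * v)"
  have "E \<noteq> 0" using ne by (simp add: E_def)
  have "\<alpha> * \<beta> - ((1 + u) / (1 + p * u))\<^sup>2 = 
    ((1 - p * u * v) * (p * v - u) * (1 + p * u)\<^sup>2 - p * (1 - p\<^sup>2 * u * v) * (v - u) * (1 + u)\<^sup>2) /
      (E * (1 + p * u)\<^sup>2)"
    using ne by (simp add: \<alpha>_def \<beta>_def E_def divide_simps)
  also have "(1 - p * u * v) * (p * v - u) * (1 + p * u)\<^sup>2 - p * (1 - p\<^sup>2 * u * v) * (v - u) * (1 + u)\<^sup>2 =
      (p - 1) * u * (1 - p * u\<^sup>2) * (1 + p * v)\<^sup>2" by algebra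
  finally have 1: "\<alpha> * \<beta> - ((1 + u) / (1 + p * u))\<^sup>2 = 
    (p - 1) * u * (1 - p * u\<^sup>2) * (1 + p * v)\<^sup>2 / (E * (1 + p * u)\<^sup>2)" .
  have "(1 - v) * \<beta> - (1 - p\<^sup>2 * v) * \<alpha> / p =
     ((1 - v) * (p * v - u) * (1 - p\<^sup>2 * u * v) - (1 - p\<^sup>2 * v) * (1 - p * u * v) * (v - u)) / E"
    using ne by (simp add: \<alpha>_def \<beta>_def E_def divide_simps)
  also have "(1 - v) * (p * v - u) * (1 - p\<^sup>2 * u * v) - (1 - p\<^sup>2 * v) * (1 - p * u * v) * (v - u) =
     v * (p - 1) * (1 - u) * (1 - p * u) * (1 + p * v)" by algebra
  finally have 2: "(1 - v) * \<beta> - (1 - p\<^sup>2 * v) * \<alpha> / p =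
     v * (p - 1) * (1 - u) * (1 - p * u) * (1 + p * v) / E" .
  show ?thesis unfolding 1 2 using ne \<open>E \<noteq> 0\<close>
    by (simp add: power2_eq_square mult_ac)
qed
text \<open>This is \<open>wz_certificate\<close> multiplied by
  \<open>p ^ i / (gauss_prod p (2 * i + j + 1) * gauss_prod p j)\<close>. It compares the summands
  for \<open>n = i + j\<close> and \<open>n + 1\<close>; using \<open>j\<close> in place of
  \<open>n - i\<close> avoids truncated subtraction.\<close>

lemma finite_lambert_telescope:
  fixes p :: real and i j :: nat
  assumes p: "0 < p" "p < 1"
  defines "u \<equiv> p ^ (2 * (i + j + 1))"
  shows "p ^ i / (1 + p ^ (2 * i + 1)) / (gauss_prod p (2 * i + j + 2) * gauss_prod p (j + 1)) -
         ((1 + u) / (1 + p * u))\<^sup>2 *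
           (p ^ i / (1 + p ^ (2 * i + 1)) / (gauss_prod p (2 * i + j + 1) * gauss_prod p j)) =
         u * (1 - p * u\<^sup>2) / ((1 + p * u)\<^sup>2 * (1 - u) * (1 - p * u)) *
           ((1 - p ^ (2 * i)) / p ^ i / (gauss_prod p (2 * i + j + 1) * gauss_prod p (j + 1)) -
            (1 - p ^ (2 * Suc i)) / p ^ Suc i / (gauss_prod p (2 * i + j + 2) * gauss_prod p j))"
proof -
  let ?P = "gauss_prod p"
  define v c where "v = p ^ (2 * i)" and "c = p ^ (2 * j)"
  define \<alpha> \<beta> where "\<alpha> = (1 - p * u * v) / (1 - p\<^sup>2 * u * v)" and "\<beta> = (p * v - u) / (p * (v - u))"
  have u: "u = p\<^sup>2 * v * c"
    by (simp add: u_def v_def c_def algebra_simps power2_eq_square power_add power_mult)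
  have pos: "v > 0" "c > 0" "u > 0" using p by (simp_all add: v_def c_def u_def)
  have e: "p * u = p ^ (2 * (i + j + 1) + 1)" "p * c = p ^ (2 * j + 1)" "p\<^sup>2 * c = p ^ (2 * j + 2)"
    by (simp_all add: u_def c_def power2_eq_square)
  have e': "p * u * v = p ^ (2 * (2 * i + j + 1) + 1)" "p\<^sup>2 * u * v = p ^ (2 * (2 * i + j + 1) + 2)"
    unfolding u_def v_def power_Suc[symmetric] power_add[symmetric]
    by (rule arg_cong[of _ _ "power p"], simp)+
  have "u < 1" "p * u < 1" "p * c < 1" "p\<^sup>2 * c < 1" "p * u * v < 1" "p\<^sup>2 * u * v < 1"
    unfolding e' unfolding e unfolding u_def using p by (simp_all add: power_lt_one del: power_Suc)
  \<comment> \<open>These factorizations identify \<open>\<beta>\<close>, written in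
    \<open>u\<close> and \<open>v\<close> only, with the reciprocal of the last factor of
    \<open>gauss_prod p (j + 1)\<close>.\<close>
  moreover have "v - u = v * (1 - p\<^sup>2 * c)" "p * v - u = p * v * (1 - p * c)" 
    unfolding u by algebra+
  ultimately have ne: "p \<noteq> 0" "v \<noteq> 0" "v - u \<noteq> 0" "1 - p\<^sup>2 * u * v \<noteq> 0" "1 - u \<noteq> 0" "1 - p * u \<noteq> 0"
      "1 + p * u \<noteq> 0" "1 + p * v \<noteq> 0"
    and \<beta>: "(1 - p * c) / (1 - p\<^sup>2 * c) = \<beta>"
    using pos p by (simp_all add: \<beta>_def add_pos_pos less_imp_neq[THEN not_sym])
  have 1: "1 / ?P (j + 1) = \<beta> / ?P j" 
    unfolding \<beta>[symmetric] e(2,3) by (simp add: gauss_prod_Suc)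
  have 2: "1 / ?P (2 * i + j + 2) = \<alpha> / ?P (2 * i + j + 1)"
    using gauss_prod_Suc[of p "2 * i + j + 1"] unfolding \<alpha>_def e' by simp
  define Q W z where "Q = ?P (2 * i + j + 1)" and "W = ?P j" and "z = p ^ i"
  have z: "v = z\<^sup>2" "z \<noteq> 0" using p by (simp_all add: z_def v_def mult.commute flip: power_mult)
  have prods: "x / (?P (2 * i + j + 2) * ?P (j + 1)) = x * (\<alpha> * \<beta>) / (Q * W)"
    "x / (?P (2 * i + j + 1) * ?P (j + 1)) = x * \<beta> / (Q * W)"
    "x / (?P (2 * i + j + 2) * ?P j) = x * \<alpha> / (Q * W)" for x
    using arg_cong2[OF 2 1, of "\<lambda>y t. x * (y * t)"] arg_cong[OF 1, of "\<lambda>t. x / Q * t"] 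
          arg_cong[OF 2, of "\<lambda>t. x / W * t"]
    by (simp_all add: Q_def W_def mult_ac)
  have v: "p ^ (2 * i + 1) = p * v" "p ^ (2 * Suc i) = p\<^sup>2 * v" "p ^ Suc i = p * z"
    by (simp_all add: v_def z_def power2_eq_square)
  have "z / (1 + p * v) * (\<alpha> * \<beta>) / (Q * W) - ((1 + u) / (1 + p * u))\<^sup>2 * (z / (1 + p * v) / (Q * W)) =
        z / (Q * W) * ((\<alpha> * \<beta> - ((1 + u) / (1 + p * u))\<^sup>2) / (1 + p * v))"
    by (simp add: diff_divide_distrib right_diff_distrib mult_ac)
  also have "(\<alpha> * \<beta> - ((1 + u) / (1 + p * u))\<^sup>2) / (1 + p * v) = 
     u * (1 - p * u\<^sup>2) / ((1 + p * u)\<^sup>2 * (1 - u) * (1 - p * u)) *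
     ((1 - v) * \<beta> - (1 - p\<^sup>2 * v) * \<alpha> / p) / v"
    unfolding \<alpha>_def \<beta>_def by (rule wz_certificate[OF ne])
  also have "z / (Q * W) * \<dots> = u * (1 - p * u\<^sup>2) / ((1 + p * u)\<^sup>2 * (1 - u) * (1 - p * u)) *
     ((1 - v) / z * \<beta> / (Q * W) - (1 - p\<^sup>2 * v) / (p * z) * \<alpha> / (Q * W))"
  proof -
    have "z / (Q * W) * (k * (a * \<beta>' - b * \<alpha>' / p) / v) = 
          k * (a / z * \<beta>' / (Q * W) - b / (p * z) * \<alpha>' / (Q * W))" for k a b \<alpha>' \<beta>'
      unfolding z(1) using z(2) by (simp add: power2_eq_square diff_divide_distrib right_diff_distrib mult_ac)
    then show ?thesis .
  qed
  finally show ?thesis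
    unfolding v z_def[symmetric] v_def[symmetric] prods unfolding Q_def[symmetric] W_def[symmetric] .
qed

text \<open>Induction on \<open>n\<close>: summing the telescoping relation multiplies the old sum
  by \<open>R\<close>, which is the quotient of the squares for \<open>n + 1\<close> and
  \<open>n\<close>. The boundary term cancels the additional summand
  \<open>i = n + 1\<close>.\<close>

lemma finite_lambert_eq_square:
  assumes p: "0 < p" "p < 1"
  shows "(\<Sum>i<Suc n. p ^ i / (1 + p ^ (2 * i + 1)) / (gauss_prod p (Suc n + i) * gauss_prod p (n - i))) =
         ((\<Prod>i<n. (1 + p ^ (2 * i + 2)) / (1 + p ^ (2 * i + 1))) / (1 + p ^ (2 * n + 1)))\<^sup>2"
proof (induction n)
  case 0
  have "(1 - p\<^sup>2) = (1 - p) * (1 + p)" by algebra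
  then show ?case using p by (simp add: gauss_prod_Suc power2_eq_square)
next
  case (Suc n)
  let ?P = "gauss_prod p"
  define u where "u = p ^ (2 * Suc n)"
  define R where "R = ((1 + u) / (1 + p * u))\<^sup>2"
  define \<kappa> where "\<kappa> = u * (1 - p * u\<^sup>2) / ((1 + p * u)\<^sup>2 * (1 - u) * (1 - p * u))"
  define a where "a = (\<lambda>n i. p ^ i / (1 + p ^ (2 * i + 1)) / (?P (Suc n + i) * ?P (n - i)))"
  define K where "K = (\<lambda>i. (1 - p ^ (2 * i)) / p ^ i / (?P (Suc n + i) * ?P (Suc n - i)))"
  have u: "u > 0" "u < 1" "p * u > 0"
    using p by (simp_all add: u_def power_lt_one del: power_Suc)
  with p have "p * u < 1 * 1" by (intro mult_strict_mono) auto
  with u have u: "u > 0" "u < 1" "p * u > 0" "p * u < 1" by simp_all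
  have step: "a (Suc n) i = R * a n i + \<kappa> * (K i - K (Suc i))" if "i < Suc n" for i
  proof -
    have "i \<le> n" using that by simp
    then obtain j where j: "n = i + j" using le_Suc_ex by blast
    have e: "Suc (Suc (i + j)) + i = 2 * i + j + 2" "Suc (i + j) + Suc i = 2 * i + j + 2" 
      "Suc (i + j) + i = 2 * i + j + 1" "Suc (i + j) - Suc i = j" "Suc (i + j) - i = j + 1"
      "i + j - i = j" by auto
    have u_eq: "u = p ^ (2 * (i + j + 1))" unfolding u_def j by simp
    have "a (Suc n) i - R * a n i = \<kappa> * (K i - K (Suc i))"
      unfolding a_def R_def \<kappa>_def K_def j e unfolding u_eq by (rule finite_lambert_telescope[OF p])
    then show ?thesis by (simp only: diff_eq_eq add.commute)
  qed
  have "(\<Sum>i<Suc (Suc n). a (Suc n) i) = 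
        R * (\<Sum>i<Suc n. a n i) + \<kappa> * (\<Sum>i<Suc n. K i - K (Suc i)) + a (Suc n) (Suc n)"
    unfolding sum.lessThan_Suc[of _ "Suc n"] sum_distrib_left sum.distrib[symmetric]
    using step by (intro arg_cong2[of _ _ _ _ "(+)"] sum.cong) auto
  \<comment> \<open>\<open>K 0 = 0\<close> because of the factor \<open>1 - p ^ 0\<close>, so only
    the upper boundary survives.\<close>
  also have "(\<Sum>i<Suc n. K i - K (Suc i)) = - K (Suc n)"
    unfolding sum_lessThan_telescope' by (simp add: K_def)
  also have "R * (\<Sum>i<Suc n. a n i) + \<kappa> * - K (Suc n) + a (Suc n) (Suc n) = R * (\<Sum>i<Suc n. a n i)"
  proof -
    define z where "z = p ^ Suc n"
    have z: "z > 0" "u = z\<^sup>2" using p by (simp_all only: z_def u_def power_even_eq zero_less_power)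
    define D where "D = ?P (2 * Suc n)"
    have P_eq: "?P (Suc (2 * Suc n)) = D * ((1 - p\<^sup>2 * u\<^sup>2) / (1 - p * u\<^sup>2))"
      unfolding gauss_prod_Suc D_def
      by (simp add: u_def algebra_simps power2_eq_square flip: power_add)
    have e: "Suc (Suc n) + Suc n = Suc (2 * Suc n)" "Suc n + Suc n = 2 * Suc n" by simp_all
    have pu: "p ^ (2 * Suc n + 1) = p * u" by (simp add: u_def)
    have "a (Suc n) (Suc n) = z / (1 + p * u) / (D * ((1 - p\<^sup>2 * u\<^sup>2) / (1 - p * u\<^sup>2)))"
      unfolding a_def e pu P_eq z_def[symmetric] by simp
    also have "1 - p\<^sup>2 * u\<^sup>2 = (1 - p * u) * (1 + p * u)" by algebra
    finally have A: "a (Suc n) (Suc n) = 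
      z / (1 + p * u) / (D * ((1 - p * u) * (1 + p * u) / (1 - p * u\<^sup>2)))" .
    have K: "K (Suc n) = (1 - u) / z / D"
      unfolding K_def e u_def[symmetric] z_def[symmetric] D_def by simp
    \<comment> \<open>\<open>X\<close>, \<open>Y\<close>, \<open>V\<close>, \<open>w\<close> stand
      for \<open>1 - p * u\<^sup>2\<close>, \<open>1 + p * u\<close>, \<open>1 - p * u\<close> and
      \<open>1 - u\<close>.\<close>
    have cancel: "u * X / (Y\<^sup>2 * w * V) * (w / z / D) = z / Y / (D * (V * Y / X))"
      if "w \<noteq> 0" for X Y V w
      unfolding z(2) using z(1) that by (simp add: power2_eq_square mult_ac)
    have "\<kappa> * K (Suc n) = a (Suc n) (Suc n)"
      unfolding A K \<kappa>_def by (rule cancel) (use u in simp)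
    then show ?thesis by simp
  qed
  also have "(\<Sum>i<Suc n. a n i) = 
     ((\<Prod>i<n. (1 + p ^ (2 * i + 2)) / (1 + p ^ (2 * i + 1))) / (1 + p ^ (2 * n + 1)))\<^sup>2"
    unfolding a_def by (rule Suc.IH)
  also have "R * \<dots> = ((\<Prod>i<Suc n. (1 + p ^ (2 * i + 2)) / (1 + p ^ (2 * i + 1))) / 
                    (1 + p ^ (2 * Suc n + 1)))\<^sup>2"
  proof -
    have "2 * n + 2 = 2 * Suc n" by simp
    moreover have "p ^ (2 * Suc n + 1) = p * u" by (simp add: u_def)
    ultimately show ?thesis
      unfolding R_def power_mult_distrib[symmetric] by (simp only: prod.lessThan_Suc flip: u_def) (simp add: mult_ac)
  qed
  finally show ?case by (simp only: a_def)
qed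

text \<open>Factor by factor this is \<open>1 - a\<^sup>2 = (1 - a) * (1 + a)\<close>; it exposes
  the right side of the finite identity as a quotient with a known limit.\<close>

lemma prod_ratio_eq_gauss_prod:
  assumes p: "0 < p" "p < 1"
  shows "(\<Prod>i<n. (1 + p ^ (2 * i + 2)) / (1 + p ^ (2 * i + 1))) = gauss_prod (p\<^sup>2) n / gauss_prod p n"
proof -
  have "(1 + p ^ (2 * i + 2)) / (1 + p ^ (2 * i + 1)) =
        ((1 - (p\<^sup>2) ^ (2 * i + 2)) / (1 - (p\<^sup>2) ^ (2 * i + 1))) / ((1 - p ^ (2 * i + 2)) / (1 - p ^ (2 * i + 1)))" 
    for i
  proof -
    define a b where "a = p ^ (2 * i + 2)" and "b = p ^ (2 * i + 1)"
    have "a < 1" "b < 1" "a > 0" "b > 0"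
      using p by (simp_all add: power_lt_one a_def b_def del: power_Suc)
    moreover have sq: "(p\<^sup>2) ^ (2 * i + 2) = a\<^sup>2" "(p\<^sup>2) ^ (2 * i + 1) = b\<^sup>2"
      by (simp_all only: a_def b_def mult.commute flip: power_mult)
    moreover have "1 - a\<^sup>2 = (1 - a) * (1 + a)" "1 - b\<^sup>2 = (1 - b) * (1 + b)" by algebra+
    ultimately show ?thesis
      unfolding sq unfolding a_def[symmetric] b_def[symmetric] by (simp add: divide_simps)
  qed
  then show ?thesis unfolding gauss_prod_def by (simp only: prod_dividef)
qed

section \<open>Passage to the limit in the finite identity\<close>

lemma lambert_psi_square:
  assumes p: "0 < p" "p < 1"
  shows "(\<lambda>i. p ^ i / (1 + p ^ (2 * i + 1))) sums (psi (p\<^sup>2))\<^sup>2"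
proof -
  let ?P = "gauss_prod p" and ?b = "\<lambda>i. p ^ i / (1 + p ^ (2 * i + 1))"
  \<comment> \<open>Extending by 0 beyond \<open>i = n\<close> turns the finite sums into series
    over a fixed index set, as Tannery's theorem requires, and masks the truncated
    \<open>n - i\<close>.\<close>
  define a where "a = (\<lambda>i n. if i \<le> n then ?b i / (?P (Suc n + i) * ?P (n - i)) else 0)"
  have P: "?P k \<ge> 1" for k by (rule gauss_prod_ge_1[OF p])
  have lim: "?P \<longlonglongrightarrow> psi p" by (rule gauss_prod_tendsto[OF p])
  have lim2: "gauss_prod (p\<^sup>2) \<longlonglongrightarrow> psi (p\<^sup>2)" 
    by (rule gauss_prod_tendsto) (use p in \<open>simp_all add: power_lt_one\<close>)
  have psi: "psi p \<ge> 1" using LIMSEQ_le_const[OF lim] P by blast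
  have b: "0 \<le> ?b i" "?b i \<le> p ^ i" for i
    using p by (simp_all add: divide_le_eq mult_le_cancel_left1 del: power_Suc)
  have *: "(\<lambda>n. a i n) \<longlonglongrightarrow> ?b i / (psi p)\<^sup>2" for i
  proof -
    have "(\<lambda>n. ?P (n + Suc i)) \<longlonglongrightarrow> psi p"
      by (rule LIMSEQ_ignore_initial_segment[OF lim])
    moreover have "(\<lambda>n. ?P (n - i)) \<longlonglongrightarrow> psi p"
      by (rule LIMSEQ_offset[of _ i]) (simp add: lim)
    ultimately have "(\<lambda>n. ?b i / (?P (n + Suc i) * ?P (n - i))) \<longlonglongrightarrow> ?b i / (psi p * psi p)"
      using psi by (intro tendsto_intros) auto
    moreover have "eventually (\<lambda>n. ?b i / (?P (n + Suc i) * ?P (n - i)) = a i n) sequentially"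
      using eventually_ge_at_top[of i] by eventually_elim (simp add: a_def add_ac)
    ultimately show ?thesis
      unfolding power2_eq_square by (rule Lim_transform_eventually)
  qed
  have bound: "norm (a i n) \<le> p ^ i" for i n
  proof (cases "i \<le> n")
    case True
    have "1 * 1 \<le> ?P (Suc n + i) * ?P (n - i)"
      using P by (intro mult_mono) (auto intro: order_trans[OF zero_le_one])
    then have "?b i / (?P (Suc n + i) * ?P (n - i)) \<le> ?b i / 1"
      using b(1)[of i] by (intro divide_left_mono) auto
    moreover have "0 \<le> ?b i / (?P (Suc n + i) * ?P (n - i))"
      using P[THEN order_trans[OF zero_le_one]] b(1)[of i] 
      by (metis divide_nonneg_nonneg mult_nonneg_nonneg)
    moreover have "a i n = ?b i / (?P (Suc n + i) * ?P (n - i))"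
      using True by (simp only: a_def if_True)
    ultimately show ?thesis using b(2)[of i] by (simp only: real_norm_def abs_of_nonneg)
  qed (use p in \<open>simp add: a_def\<close>)
  have tannery: "summable (\<lambda>i. norm (?b i / (psi p)\<^sup>2)) \<and> 
        (\<lambda>n. \<Sum>i. a i n) \<longlonglongrightarrow> (\<Sum>i. ?b i / (psi p)\<^sup>2)"
  proof -
    have "\<forall>\<^sub>F (i, n) in at_top \<times>\<^sub>F sequentially. norm (a i n) \<le> p ^ i"
      by (rule always_eventually) (use bound in simp)
    moreover have "summable (\<lambda>i. p ^ i)" using p by simp
    ultimately show ?thesis
      using tannerys_theorem[OF *, where M = "\<lambda>i. p ^ i"] by (meson sequentially_bot)
  qed
  \<comment> \<open>The \<open>0\<close> is the limit of \<open>p ^ (2 * n + 1)\<close> in the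
    denominator of the finite identity.\<close>
  have "(\<lambda>n. \<Sum>i. a i n) \<longlonglongrightarrow> (psi (p\<^sup>2) / psi p / (1 + 0))\<^sup>2"
  proof -
    have "(\<Sum>i. a i n) = (\<Sum>i<Suc n. a i n)" for n
      by (rule suminf_finite) (auto simp: a_def)
    also have "(\<Sum>i<Suc n. a i n) = (gauss_prod (p\<^sup>2) n / ?P n / (1 + p ^ (2 * n + 1)))\<^sup>2" for n
      unfolding prod_ratio_eq_gauss_prod[OF p, symmetric] finite_lambert_eq_square[OF p, symmetric]
      by (rule sum.cong) (auto simp: a_def)
    finally have eq: "(\<Sum>i. a i n) = (gauss_prod (p\<^sup>2) n / ?P n / (1 + p ^ (2 * n + 1)))\<^sup>2" for n .
    have "(\<lambda>n. p ^ (2 * n + 1)) \<longlonglongrightarrow> 0"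
      using p by (intro LIMSEQ_subseq_LIMSEQ[where f = "\<lambda>n. 2 * n + 1", OF LIMSEQ_power_zero, unfolded comp_def])
                 (auto simp: strict_mono_def)
    then show ?thesis unfolding eq
      using psi by (intro tendsto_intros lim lim2) auto
  qed
  then have lim_eq: "(\<Sum>i. ?b i / (psi p)\<^sup>2) = (psi (p\<^sup>2) / psi p)\<^sup>2"
    using LIMSEQ_unique[OF conjunct2[OF tannery]] by simp
  have "summable (\<lambda>i. ?b i / (psi p)\<^sup>2)"
    by (rule summable_norm_cancel[OF conjunct1[OF tannery]])
  then have "(\<lambda>i. ?b i / (psi p)\<^sup>2) sums (psi (p\<^sup>2) / psi p)\<^sup>2"
    unfolding lim_eq[symmetric] by (rule summable_sums)
  from sums_mult[OF this, of "(psi p)\<^sup>2"] show ?thesis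
    using psi by (simp add: power_divide)
qed

section \<open>The theta series in terms of \<open>psi\<close>\<close>

lemma nome_power_add: "nome_power \<tau> (x + y) = nome_power \<tau> x * nome_power \<tau> y"
  by (simp add: nome_power_def algebra_simps exp_add)

lemma nome_power_mult_nat: "nome_power \<tau> (real n * x) = nome_power \<tau> x ^ n"
  by (simp add: nome_power_def mult_ac flip: exp_of_nat_mult)

text \<open>For \<open>n \<ge> 0\<close> the exponent is \<open>1/4\<close> plus
  \<open>4 * (n * (n + 1) div 2)\<close> halves, so these terms sum to
  \<open>nome_power \<tau> (1/4) * psi (r ^ 4)\<close>. The reflection
  \<open>n \<mapsto> - 1 - n\<close> preserves the exponent and carries this half to the negative
  indices, which gives the factor 2. Here \<open>r\<close> may be negative, as it is for
  \<open>phi' s\<close>.\<close>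

lemma jacobi_theta2_eq_psi:
  fixes r :: real
  assumes r: "0 < \<bar>r\<bar>" "\<bar>r\<bar> < 1" and \<tau>: "nome_power \<tau> (1/2) = of_real r"
  shows "jacobi_theta2 \<tau> = nome_power \<tau> (1/4) * of_real (2 * psi (r ^ 4))"
proof -
  let ?f = "\<lambda>n::int. nome_power \<tau> ((of_int n + 1/2)\<^sup>2)" and ?w = "nome_power \<tau> (1/4)"
  have r4: "0 < r ^ 4" "r ^ 4 < 1"
    using r power_lt_one[of "\<bar>r\<bar>" 4] by (auto simp: power_even_abs)
  have "((\<lambda>k. (r ^ 4) ^ (k * (k + 1) div 2)) has_sum psi (r ^ 4)) UNIV"
    unfolding psi_def using r4
    by (intro sums_nonneg_imp_has_sum summable_sums summable_psi) auto
  then have "((\<lambda>k. ?w * of_real ((r ^ 4) ^ (k * (k + 1) div 2))) has_sum 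
               ?w * of_real (psi (r ^ 4))) (UNIV :: nat set)"
    by (intro has_sum_cmult_right has_sum_of_real)
  also have "(\<lambda>k. ?w * of_real ((r ^ 4) ^ (k * (k + 1) div 2))) = (\<lambda>k. ?f (int k))"
  proof
    fix k :: nat
    have "even (k * (k + 1))" by simp
    then have "4 * (k * (k + 1) div 2) = 2 * (k * (k + 1))" by presburger
    then have "real (4 * (k * (k + 1) div 2)) = 2 * (real k * (real k + 1))"
      by (simp add: algebra_simps)
    then have "(of_int (int k) + 1/2)\<^sup>2 = 1/4 + real (4 * (k * (k + 1) div 2)) * (1/2)"
      by (simp add: power2_eq_square algebra_simps)
    then show "?w * of_real ((r ^ 4) ^ (k * (k + 1) div 2)) = ?f (int k)"
      by (simp only: nome_power_add nome_power_mult_nat \<tau> power_mult of_real_power)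
  qed
  finally have nonneg: "((\<lambda>k. ?f (int k)) has_sum ?w * of_real (psi (r ^ 4))) UNIV" .
  have A: "(?f has_sum ?w * of_real (psi (r ^ 4))) {0..}"
    using nonneg
    by (subst has_sum_reindex_bij_witness[where S = "{0..}" and T = UNIV and i = int and j = nat]) auto
  have B: "(?f has_sum ?w * of_real (psi (r ^ 4))) {..<0}"
    using A
  proof (subst has_sum_reindex_bij_witness[where S = "{..<0}" and T = "{0..}" 
           and i = "\<lambda>n. - 1 - n" and j = "\<lambda>n. - 1 - n"])
    fix n :: int
    have "(real_of_int (- 1 - n) + 1/2)\<^sup>2 = (real_of_int n + 1/2)\<^sup>2" 
      by (simp add: power2_eq_square algebra_simps)
    then show "?f (- 1 - n) = ?f n" by simp
  qed auto
  have "(?f has_sum (?w * of_real (psi (r ^ 4)) + ?w * of_real (psi (r ^ 4)))) ({0..} \<union> {..<0})"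
    by (rule has_sum_Un_disjoint[OF A B]) auto
  also have "{0..} \<union> {..<0} = (UNIV :: int set)" by auto
  finally have "jacobi_theta2 \<tau> = ?w * of_real (psi (r ^ 4)) + ?w * of_real (psi (r ^ 4))"
    unfolding jacobi_theta2_def by (rule infsumI)
  then show ?thesis by (simp add: algebra_simps)
qed

section \<open>Binet's formula and the conclusion\<close>

text \<open>Both \<open>phi' s\<close> and \<open>- 1 / phi' s\<close> are roots of
  \<open>x\<^sup>2 = s * x + 1\<close>, and \<open>sqrt (s\<^sup>2 + 4)\<close> is their difference.
  Writing the second root as a reciprocal leaves only powers of \<open>phi' s\<close>.\<close>

lemma gfib_binet:
  "sqrt (s\<^sup>2 + 4) * gfib s n = (- 1 / phi' s) ^ n - phi' s ^ n"
proof (induction s n rule: gfib.induct)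
  case (1 s)
  show ?case by simp
next
  case (2 s)
  have "phi' s * (s - phi' s) = - 1" 
    by (simp add: phi'_def field_simps power2_eq_square)
  then have "- 1 / phi' s = s - phi' s"
    using phi'_neg[of s] by (subst nonzero_divide_eq_eq) (simp_all add: mult.commute)
  moreover have "sqrt (s\<^sup>2 + 4) = s - phi' s - phi' s"
    by (simp add: phi'_def field_simps)
  ultimately show ?case by (simp only: gfib.simps power_Suc0_right mult_1_right)
next
  case (3 s n)
  define f where "f = phi' s"
  have f: "f\<^sup>2 = s * f + 1"
    by (simp add: f_def phi'_def power2_eq_square field_simps)
  have g: "(- 1 / f)\<^sup>2 = s * (- 1 / f) + 1"
  proof -
    have "f * (s - f) = - 1" using f by (simp add: algebra_simps power2_eq_square)
    then have inv: "- 1 / f = s - f"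
      using phi'_neg[of s] by (subst nonzero_divide_eq_eq) (simp_all add: f_def mult.commute)
    show ?thesis unfolding inv using f by algebra
  qed
  have "sqrt (s\<^sup>2 + 4) * gfib s (Suc (Suc n)) = 
        s * (sqrt (s\<^sup>2 + 4) * gfib s (Suc n)) + sqrt (s\<^sup>2 + 4) * gfib s n"
    by (simp add: algebra_simps)
  also have "\<dots> = (- 1 / f) ^ n * (s * (- 1 / f) + 1) - f ^ n * (s * f + 1)"
    unfolding 3 f_def[symmetric] by (simp add: algebra_simps)
  also have "\<dots> = (- 1 / f) ^ Suc (Suc n) - f ^ Suc (Suc n)"
    unfolding f[symmetric] g[symmetric] by (simp only: power_add[symmetric] Suc_eq_plus1 add.assoc one_add_one)
  finally show ?case by (simp only: f_def)
qed

theorem theorem10: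
  fixes s :: real and \<tau> :: complex
  assumes "s \<noteq> 0"
    and "Im \<tau> > 0"
    and "nome_power \<tau> 1 = (of_real (phi' s))\<^sup>2"
    and "nome_power \<tau> (1/2) = of_real (phi' s)"
  shows "(\<lambda>n. complex_of_real (1 / gfib s (2 * Suc n - 1))) sums
           (- (of_real (sqrt (s\<^sup>2 + 4)) / 4) * (jacobi_theta2 \<tau>)\<^sup>2)"
proof -
  define r D where "r = - phi' s" and "D = sqrt (s\<^sup>2 + 4)"
  \<comment> \<open>The conditions on \<open>\<tau>\<close> force
    \<open>\<bar>phi' s\<bar> < 1\<close>, hence \<open>s > 0\<close>.\<close>
  have "s > 0" using assms ex_phi'_nome_iff by blast
  then have r: "0 < r" "r < 1"
    using phi'_neg[of s] abs_phi'_less_1_iff[of s] by (auto simp: r_def)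
  have "D > 0" by (simp add: D_def add_nonneg_pos)
  \<comment> \<open>The index \<open>2 * Suc n - 1\<close> is \<open>2 * n + 1\<close>. At an odd
    index the minus sign in Binet's formula turns into a plus, so the reciprocal is
    \<open>D * x / (1 + x\<^sup>2)\<close>, a Lambert summand with
    \<open>p = r\<^sup>2\<close>.\<close>
  have summand: "D * r * ((r\<^sup>2) ^ n / (1 + (r\<^sup>2) ^ (2 * n + 1))) = 1 / gfib s (2 * Suc n - 1)" for n
  proof -
    define x where "x = r ^ (2 * n + 1)"
    have x: "x > 0" using r by (simp add: x_def)
    have "D * gfib s (2 * n + 1) = (1 / r) ^ (2 * n + 1) - (- r) ^ (2 * n + 1)"
      unfolding D_def gfib_binet by (simp add: r_def)
    also have "\<dots> = 1 / x + x" by (simp add: x_def power_divide)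
    also have "\<dots> = (1 + x\<^sup>2) / x" using x by (simp add: field_simps power2_eq_square)
    finally have binet: "D * gfib s (2 * n + 1) = (1 + x\<^sup>2) / x" .
    have "1 / gfib s (2 * n + 1) = D / (D * gfib s (2 * n + 1))"
      using \<open>D > 0\<close> by simp
    then have "1 / gfib s (2 * n + 1) = D * (x / (1 + x\<^sup>2))" 
      unfolding binet by simp
    moreover have "x = r * (r\<^sup>2) ^ n" "x\<^sup>2 = (r\<^sup>2) ^ (2 * n + 1)"
      by (simp_all only: x_def mult.commute power_mult[symmetric]) simp
    ultimately show ?thesis by simp
  qed
  have "(\<lambda>n. 1 / gfib s (2 * Suc n - 1)) sums (D * r * (psi ((r\<^sup>2)\<^sup>2))\<^sup>2)"
    unfolding summand[symmetric] 
    by (intro sums_mult lambert_psi_square) (use r in \<open>simp_all add: power_lt_one\<close>)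
  then have sums: "(\<lambda>n. complex_of_real (1 / gfib s (2 * Suc n - 1))) sums 
              of_real (D * r * (psi (r ^ 4))\<^sup>2)"
    by (intro sums_of_real) (simp flip: power_mult)
  \<comment> \<open>Squaring \<open>jacobi_theta2 \<tau>\<close> turns the quarter power into the
    half power, whose value is prescribed as \<open>phi' s = - r\<close>.\<close>
  have w: "(nome_power \<tau> (1/4))\<^sup>2 = - of_real r"
    using nome_power_mult_nat[of \<tau> 2 "1/4"] assms(4) by (simp add: r_def)
  have "jacobi_theta2 \<tau> = nome_power \<tau> (1/4) * of_real (2 * psi (r ^ 4))"
    using jacobi_theta2_eq_psi[of "phi' s" \<tau>] r assms(4) by (simp add: r_def)
  then have "(jacobi_theta2 \<tau>)\<^sup>2 = - of_real (4 * r * (psi (r ^ 4))\<^sup>2)"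
    by (simp add: power_mult_distrib w)
  then have "- (of_real (sqrt (s\<^sup>2 + 4)) / 4) * (jacobi_theta2 \<tau>)\<^sup>2 = 
             complex_of_real (D * r * (psi (r ^ 4))\<^sup>2)"
    by (simp add: D_def)
  with sums show ?thesis by simp
qed

end
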